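(* Let $h\in\mathrm{Lip}_{[2]}(\mathbb{R})$. There exists a constant $C>0$ such that \[ \big|\mathbb{E}\big[\mathscr{L}_0\mathbf{P}^0_t h(Z_n)\big]\big|\le C\,\frac{\log n}{n}\quad\text{for all } t\in[0,1] \text{ and all } n\ge2. \]
   Context: $Z$ denotes a standard Gumbel random variable (density $e^{-(x+e^{-x})}$). For $t\ge0$, $\mathbf{P}^0_t f(x)=\mathbb{E}\big[f\big(\max(x-t,\ Z+\log(1-e^{-t}))\big)\big]$ (convention $\log0=-\infty$), and $\mathscr{L}_0 f(x)=-f'(x)+e^{-x}\mathbb{E}[f'(x+Y)]$ with $Y\sim\mathcal{E}(1)$ (the generator of $(\mathbf{P}^0_t)$). $Z_n=\frac{T_n}{n}-\log n$, where $T_n$ is the coupon collector's completion time for $n$ coupons. $\mathrm{Lip}_{[2]}(\mathbb{R})$ is the set of Lipschitz $f:\mathbb{R}\to\mathbb{R}$ whose derivative has a Lipschitz representative. *)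

theory Defs
  imports "HOL-Probability.Probability"
begin

definition gumbel :: "real measure" where
  "gumbel = density lborel (\<lambda>x. ennreal (exp (-(x + exp (-x)))))"

definition expo1 :: "real measure" where
  "expo1 = density lborel (exponential_density 1)"

text \<open>The semigroup P^0_t; for t = 0 the second argument of max is -infinity.\<close>
definition P0 :: "real \<Rightarrow> (real \<Rightarrow> real) \<Rightarrow> real \<Rightarrow> real" where
  "P0 t f x = (if t = 0 then f x
     else \<integral>z. f (max (x - t) (z + ln (1 - exp (-t)))) \<partial>gumbel)"

definition L0 :: "(real \<Rightarrow> real) \<Rightarrow> real \<Rightarrow> real" where
  "L0 f x = - deriv f x + exp (-x) * (\<integral>y. deriv f (x + y) \<partial>expo1)"

definition Lip2 :: "(real \<Rightarrow> real) \<Rightarrow> bool" where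
  "Lip2 h \<longleftrightarrow> (\<exists>L. L-lipschitz_on UNIV h) \<and>
     (\<exists>g K. K-lipschitz_on UNIV g \<and>
        (AE x in lborel. (h has_real_derivative g x) (at x)))"

definition coupon_space :: "nat \<Rightarrow> nat stream measure" where
  "coupon_space n = stream_space (measure_pmf (pmf_of_set {..<n}))"

definition coupon_T :: "nat \<Rightarrow> nat stream \<Rightarrow> nat" where
  "coupon_T n \<omega> = (LEAST m. {..<n} \<subseteq> (\<lambda>i. \<omega> !! i) ` {..<m})"

definition Zn :: "nat \<Rightarrow> nat stream \<Rightarrow> real" where
  "Zn n \<omega> = real (coupon_T n \<omega>) / real n - ln (real n)"

end

theory Submission
  imports Defs
begin

text \<open>
  Put \<open>u(x) = (P0 t h)'(x) = h'(x - t) exp(-(e^t - 1) e^(-x))\<close>, which is bounded and Lipschitz uniformly in \<open>t\<close>.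
  Then \<open>L0 (P0 t h)(x) = -u(x) + \<integral>_x^\<infinity> u(s) e^(-s) ds\<close>.
  Let \<open>F_n(m) = P(T_n \<le> m)\<close>. The last new coupon differs from all earlier draws, so
  \<open>P(T_n = m + 1) = (1 - 1/n)^m F_(n-1)(m)\<close>, and \<open>F_n \<le> F_(n-1)\<close>.
  The expectation thus compares \<open>\<Sum> u (1 - 1/n)^m F_(n-1)(m)\<close> with \<open>\<Sum> F_n(m) \<integral> u e^(-s) ds\<close>, the integrals
  being over cells of length \<open>1/n\<close>. Because the errors have a sign, they are controlled by the closed form
  \<open>\<Sum> z^m F_n(m) = 1/(1 - z) \<Prod>_(k \<le> n) k/(k + n(1/z - 1))\<close> alone: it is at most \<open>1\<close> for \<open>z = e^(-1/n)\<close> and at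
  least \<open>1 - O(ln n / n)\<close> for \<open>z = 1 - 1/n\<close>, whereas \<open>\<Sum> (1 - 1/n)^m F_(n-1)(m) \<le> 1\<close>.
\<close>

section \<open>The probability of covering a set of coupons\<close>

text \<open>\<open>cover_prob n m d\<close> is the probability that \<open>d\<close> prescribed coupons out of \<open>n\<close> all appear
  among the first \<open>m\<close> draws; the recursion conditions on the first draw.\<close>
primrec cover_prob :: "nat \<Rightarrow> nat \<Rightarrow> nat \<Rightarrow> real" where
  "cover_prob n 0 d = (if d = 0 then 1 else 0)"
| "cover_prob n (Suc m) d = (1 - real d / real n) * cover_prob n m d + real d / real n * cover_prob n m (d - 1)"

lemma cover_prob_0 [simp]: "cover_prob n m 0 = 1"
  by (induction m) auto

lemma cover_prob_bounds: "d \<le> n \<Longrightarrow> 0 \<le> cover_prob n m d \<and> cover_prob n m d \<le> 1"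
proof (induction m arbitrary: d)
  case (Suc m)
  have d: "0 \<le> real d / real n" "real d / real n \<le> 1"
    using Suc.prems by (auto simp: divide_le_eq)
  have "cover_prob n (Suc m) d \<le> (1 - real d / real n) * 1 + real d / real n * 1"
    unfolding cover_prob.simps using Suc d by (intro add_mono mult_left_mono) auto
  then show ?case using Suc d by simp
qed simp

text \<open>A larger target is harder to cover. In the induction, replacing \<open>d + 1\<close> by
  \<open>d\<close> in the first term makes both terms equal, so the weight can be changed freely
  before the second term is raised to \<open>d - 1\<close>.\<close>

lemma cover_prob_antimono: "Suc d \<le> n \<Longrightarrow> cover_prob n m (Suc d) \<le> cover_prob n m d"
proof (induction m arbitrary: d)
  case (Suc m)
  note IH = Suc.IH and prems = Suc.prems
  let ?p = "real d / real n" let ?q = "real (Suc d) / real n"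
  have p: "0 \<le> ?p" "?p \<le> ?q" "?q \<le> 1"
    using Suc.prems by (auto simp: divide_le_eq divide_right_mono)
  have "cover_prob n (Suc m) (Suc d) = (1 - ?q) * cover_prob n m (Suc d) + ?q * cover_prob n m d"
    by simp
  also have "\<dots> \<le> (1 - ?q) * cover_prob n m d + ?q * cover_prob n m d"
    using Suc p by (intro add_mono mult_left_mono) auto
  also have "\<dots> = (1 - ?p) * cover_prob n m d + ?p * cover_prob n m d" by (simp add: algebra_simps)
  also have "\<dots> \<le> (1 - ?p) * cover_prob n m d + ?p * cover_prob n m (d - 1)"
  proof (cases d)
    case (Suc d')
    then have "cover_prob n m d \<le> cover_prob n m (d - 1)" using IH[of d'] prems by simp
    then show ?thesis using p by (intro add_left_mono mult_left_mono)
  qed simp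
  finally show ?case by simp
qed simp

text \<open>An additional coupon dilutes the draws: it lowers the weight of the larger value
  \<open>cover_prob n m (d - 1)\<close> in the recursion from \<open>d / n\<close> to
  \<open>d / (n + 1)\<close>.\<close>

lemma cover_prob_mono_coupons: "d \<le> n \<Longrightarrow> cover_prob (Suc n) m d \<le> cover_prob n m d"
proof (induction m arbitrary: d)
  case (Suc m)
  show ?case
  proof (cases d)
    case (Suc d')
    let ?p = "real d / real (Suc n)" let ?q = "real d / real n"
    have p: "0 \<le> ?p" "?p \<le> ?q" "?p \<le> 1"
      using Suc.prems Suc by (auto intro!: divide_left_mono simp del: of_nat_Suc)
    have "cover_prob (Suc n) (Suc m) d \<le> (1 - ?p) * cover_prob n m d + ?p * cover_prob n m (d - 1)"
      unfolding cover_prob.simps using Suc.IH Suc.prems p by (intro add_mono mult_left_mono) auto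
    also have "\<dots> = cover_prob n m d + ?p * (cover_prob n m (d - 1) - cover_prob n m d)" by (simp add: algebra_simps)
    also have "\<dots> \<le> cover_prob n m d + ?q * (cover_prob n m (d - 1) - cover_prob n m d)"
      using cover_prob_antimono[of d' n m] Suc Suc.prems p(2)
      by (intro add_left_mono mult_right_mono) auto
    finally show ?thesis by (simp add: algebra_simps)
  qed simp
qed simp

text \<open>The draw completing the set is a coupon that is missing from the first \<open>m\<close> draws, which are then
  uniform over the remaining \<open>n\<close> coupons.\<close>
lemma cover_prob_increment:
  assumes "n \<ge> 1"
  shows "cover_prob (Suc n) (Suc m) (Suc d) - cover_prob (Suc n) m (Suc d)
    = real (Suc d) / real (Suc n) * (1 - 1 / real (Suc n)) ^ m * cover_prob n m d"
proof (induction m arbitrary: d)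
  case 0
  then show ?case by simp
next
  case IH: (Suc m)
  define q where "q = 1 - 1 / real (Suc n)"
  define a where "a = real (Suc d) / real (Suc n)"
  \<comment> \<open>The recursion is linear, so the increments in \<open>m\<close> obey it as
    well.\<close>
  have "cover_prob (Suc n) (Suc (Suc m)) (Suc d) - cover_prob (Suc n) (Suc m) (Suc d)
      = (1 - a) * (cover_prob (Suc n) (Suc m) (Suc d) - cover_prob (Suc n) m (Suc d))
        + a * (cover_prob (Suc n) (Suc m) d - cover_prob (Suc n) m d)"
    unfolding cover_prob.simps(2)[of _ "Suc m"] a_def
    by (subst (4) cover_prob.simps(2)) (simp add: algebra_simps)
  also have "\<dots> = a * q ^ m * ((1 - a) * cover_prob n m d + real d / real (Suc n) * cover_prob n m (d - 1))"
  proof -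
    have "cover_prob (Suc n) (Suc m) d - cover_prob (Suc n) m d = real d / real (Suc n) * q ^ m * cover_prob n m (d - 1)"
      using IH[of "d - 1"] by (cases d) (simp_all add: q_def del: cover_prob.simps)
    then show ?thesis
      unfolding IH a_def[symmetric] q_def[symmetric] by (simp add: algebra_simps)
  qed
  \<comment> \<open>Avoiding one fixed coupon has probability \<open>q\<close>; after dividing by
    \<open>q\<close>, the weights over \<open>Suc n\<close> coupons become those of the recursion
    over \<open>n\<close> coupons.\<close>
  also have "(1 - a) * cover_prob n m d + real d / real (Suc n) * cover_prob n m (d - 1) = q * cover_prob n (Suc m) d"
  proof -
    define N where "N = real n"
    have N: "N > 0" using assms by (simp add: N_def)
    then have "N * cover_prob n (Suc m) d = (N - real d) * cover_prob n m d + real d * cover_prob n m (d - 1)"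
      by (simp add: N_def algebra_simps)
    moreover have "1 - a = (N - real d) / (N + 1)" "q = N / (N + 1)" "real (Suc n) = N + 1"
      using N by (simp_all add: a_def q_def N_def field_simps)
    ultimately show ?thesis by (simp add: add_divide_distrib del: cover_prob.simps)
  qed
  finally show ?case by (simp add: a_def q_def del: cover_prob.simps)
qed

lemma cover_prob_last_increment:
  assumes "n \<ge> 2"
  shows "cover_prob n (Suc m) n - cover_prob n m n = (1 - 1 / real n) ^ m * cover_prob (n - 1) m (n - 1)"
proof -
  from assms obtain k where k: "n = Suc k" "k \<ge> 1" by (cases n) auto
  show ?thesis using cover_prob_increment[OF k(2), of m k] k by simp
qed

text \<open>This is the union bound over the prescribed coupons, each missed with probability
  \<open>(1 - 1/n)^m\<close>. The lower bound satisfies the recursion of \<open>cover_prob\<close>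
  with equality. It serves to show that the collection is almost surely completed.\<close>

lemma cover_prob_ge:
  assumes "n \<ge> 1"
  shows "d \<le> n \<Longrightarrow> 1 - real d * (1 - 1 / real n) ^ m \<le> cover_prob n m d"
proof (induction m arbitrary: d)
  case (Suc m)
  show ?case
  proof (cases d)
    case (Suc d')
    have p: "0 \<le> real d / real n" "real d / real n \<le> 1"
      using Suc.prems by (auto simp: divide_le_eq)
    let ?q = "1 - 1 / real n"
    have "1 - real d * ?q ^ Suc m = (1 - real d / real n) * (1 - real d * ?q ^ m)
        + real d / real n * (1 - real (d - 1) * ?q ^ m)"
      using Suc by (simp add: algebra_simps add_divide_distrib)
    also have "\<dots> \<le> cover_prob n (Suc m) d"
      unfolding cover_prob.simps using Suc.IH Suc.prems p by (intro add_mono mult_left_mono) auto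
    finally show ?thesis .
  qed simp
qed auto

text \<open>First one coupon is dropped from the target, then from the pool. This gives the later
  error terms their sign.\<close>

lemma cover_prob_fewer_coupons:
  assumes "n \<ge> 2" shows "cover_prob n m n \<le> cover_prob (n - 1) m (n - 1)"
proof -
  from assms obtain k where k: "n = Suc k" "k \<ge> 1" by (cases n) auto
  show ?thesis using cover_prob_antimono[of k "Suc k" m] cover_prob_mono_coupons[of k k m] k by simp
qed

section \<open>Generating function of the cover probabilities\<close>

lemma summable_cover_prob:
  assumes "d \<le> n" "0 \<le> z" "z < 1"
  shows "summable (\<lambda>m. z ^ m * cover_prob n m d)"
proof (rule summable_comparison_test'[where g = "\<lambda>m. z ^ m" and N = 0])
  show "summable (\<lambda>m. z ^ m)" using assms by simp
  show "norm (z ^ m * cover_prob n m d) \<le> z ^ m" for m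
    using cover_prob_bounds[OF assms(1), of m] assms by (simp add: abs_mult mult_left_le)
qed

text \<open>The term \<open>m = 0\<close> vanishes because the target is nonempty; shifting the
  index and inserting the recursion gives a linear equation between the two series.\<close>

lemma suminf_cover_prob_rec:
  assumes "Suc d \<le> n" "0 < z" "z < 1"
  shows "(\<Sum>m. z ^ m * cover_prob n m (Suc d)) * (1 / z - 1 + real (Suc d) / real n)
    = real (Suc d) / real n * (\<Sum>m. z ^ m * cover_prob n m d)"
proof -
  define A where "A = (\<Sum>m. z ^ m * cover_prob n m (Suc d))"
  define B where "B = (\<Sum>m. z ^ m * cover_prob n m d)"
  define p where "p = real (Suc d) / real n"
  have SA: "summable (\<lambda>m. z ^ m * cover_prob n m (Suc d))" and SB: "summable (\<lambda>m. z ^ m * cover_prob n m d)"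
    using assms by (auto intro!: summable_cover_prob)
  have "A = (\<Sum>m. z ^ Suc m * cover_prob n (Suc m) (Suc d))"
    using suminf_split_head[OF SA] by (simp add: A_def)
  also have "\<dots> = (\<Sum>m. z * (1 - p) * (z ^ m * cover_prob n m (Suc d)) + z * p * (z ^ m * cover_prob n m d))"
    by (simp add: p_def algebra_simps)
  also have "\<dots> = z * (1 - p) * A + z * p * B"
    unfolding A_def B_def using SA SB
    by (subst suminf_add[symmetric]) (auto intro!: summable_mult simp del: suminf_add simp: suminf_mult)
  finally have "A * (1 - z * (1 - p)) = z * p * B" by (simp add: algebra_simps)
  then have "A * (1 / z - 1 + p) = p * B"
    using assms by (simp add: field_simps)
  then show ?thesis by (simp add: A_def B_def p_def)
qed

lemma suminf_cover_prob:
  assumes "d \<le> n" "0 < z" "z < 1"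
  shows "(\<Sum>m. z ^ m * cover_prob n m d)
    = 1 / (1 - z) * (\<Prod>k=1..d. real k / (real k + real n * (1 / z - 1)))"
  using assms(1)
proof (induction d)
  case 0
  then show ?case using assms by (simp add: suminf_geometric)
next
  case (Suc d)
  have z: "1 / z - 1 > 0" using assms by (simp add: field_simps)
  have n: "real n > 0" using Suc.prems by simp
  let ?A = "\<Sum>m. z ^ m * cover_prob n m (Suc d)"
  have "?A * ((real (Suc d) + real n * (1 / z - 1)) / real n) = real (Suc d) / real n * (\<Sum>m. z ^ m * cover_prob n m d)"
    using suminf_cover_prob_rec[OF Suc.prems assms(2,3)] n
    by (simp add: add_divide_distrib diff_divide_distrib add.commute del: of_nat_Suc)
  then have "?A * (real (Suc d) + real n * (1 / z - 1)) = real (Suc d) * (\<Sum>m. z ^ m * cover_prob n m d)"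
    using n by (simp only: times_divide_eq_right times_divide_eq_left divide_cancel_right) auto
  moreover have "real (Suc d) + real n * (1 / z - 1) > 0"
    using z n by (intro add_pos_pos) auto
  ultimately have "?A = real (Suc d) / (real (Suc d) + real n * (1 / z - 1)) * (\<Sum>m. z ^ m * cover_prob n m d)"
    by (simp add: divide_simps mult.commute)
  then show ?case using Suc by (simp add: mult_ac)
qed

lemma prod_consecutive_ratio: "(\<Prod>k=1..n. real k / (real k + 1)) = 1 / (real n + 1)"
  by (induction n) (auto simp: field_simps)

text \<open>Here \<open>n (1/z - 1) \<ge> 1\<close>, so the product is at most the telescoping one
  with value \<open>1/(n + 1)\<close>, and the prefactor \<open>1/(1 - z)\<close> is at most
  \<open>n + 1\<close>.\<close>

lemma suminf_cover_prob_exp_le: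
  assumes "n \<ge> 1"
  shows "(\<Sum>m. exp (- 1 / real n) ^ m * cover_prob n m n) \<le> 1"
proof -
  define z where "z = exp (- 1 / real n)"
  have z: "0 < z" "z < 1" using assms by (auto simp: z_def)
  have iz: "1 / z \<ge> 1 + 1 / real n"
    using exp_ge_add_one_self[of "1 / real n"] by (simp add: z_def exp_minus field_simps)
  then have iz': "real n * (1 / z - 1) \<ge> 1" using assms by (simp add: field_simps)
  have "(\<Prod>k=1..n. real k / (real k + real n * (1 / z - 1))) \<le> (\<Prod>k=1..n. real k / (real k + 1))"
    using iz' by (intro prod_mono) (auto intro!: divide_left_mono mult_pos_pos)
  then have "(\<Sum>m. z ^ m * cover_prob n m n) \<le> 1 / (1 - z) * (1 / (real n + 1))"
    unfolding suminf_cover_prob[OF order_refl z] prod_consecutive_ratio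
    using z by (intro mult_left_mono) auto
  also have "\<dots> \<le> 1"
  proof -
    have "(1 + 1 / real n) * z \<le> 1 / z * z" using z iz by (intro mult_right_mono) auto
    then have "(1 - z) * (real n + 1) \<ge> 1" using z assms by (simp add: field_simps)
    then show ?thesis using z by (simp add: divide_simps)
  qed
  finally show ?thesis by (simp add: z_def)
qed

text \<open>At \<open>e = 0\<close> the product equals \<open>1/(d + 1)\<close>. To first order the
  perturbation costs the relative amount \<open>e\<close> times the sum of \<open>1/(k + 1)\<close>,
  which is at most \<open>e * ln (d + 1)\<close>.\<close>

lemma prod_ratio_ge:
  fixes e :: real
  assumes "e \<ge> 0"
  shows "(\<Prod>k=1..d. real k / (real k + (1 + e))) \<ge> (1 - e * ln (real d + 1)) / (real d + 1)"
proof (induction d)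
  case (Suc d)
  define L where "L = ln (real d + 1)"
  define x where "x = real d + 1"
  have x: "x \<ge> 1" by (simp add: x_def)
  have ln: "ln (x + 1) \<ge> L + 1 / (x + 1)"
  proof -
    have "ln (x / (x + 1)) \<le> x / (x + 1) - 1" using x by (intro ln_le_minus_one) auto
    then have "ln x - ln (x + 1) \<le> - 1 / (x + 1)" using x by (simp add: ln_div field_simps)
    then show ?thesis by (simp add: L_def x_def)
  qed
  let ?P = "\<Prod>k=1..d. real k / (real k + (1 + e))"
  have P: "?P \<ge> 0" using assms by (intro prod_nonneg) auto
  have S: "(\<Prod>k=1..Suc d. real k / (real k + (1 + e))) = ?P * (x / (x + 1 + e))"
    by (simp add: x_def add_ac)
  have goal: "(1 - e * ln (x + 1)) / (x + 1) \<le> ?P * (x / (x + 1 + e))"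
  proof (cases "1 - e * L \<ge> 0")
    \<comment> \<open>A negative lower bound stays negative as \<open>ln\<close> grows, while the
      product is nonnegative.\<close>
    case False
    have "ln (x + 1) \<ge> L" using ln x by (smt (verit) divide_nonneg_nonneg)
    then have "e * ln (x + 1) \<ge> e * L" using assms by (intro mult_left_mono)
    then have "(1 - e * ln (x + 1)) / (x + 1) \<le> 0" using False x by (intro divide_nonpos_pos) auto
    also have "\<dots> \<le> ?P * (x / (x + 1 + e))" using P x assms by simp
    finally show ?thesis .
  next
    case True
    have eL: "0 \<le> e * L" using assms x by (auto simp: L_def)
    have "e * ln (x + 1) \<ge> e * (L + 1 / (x + 1))" using ln assms by (intro mult_left_mono)
    then have "(1 - e * ln (x + 1)) / (x + 1) \<le> (1 - e * L - e / (x + 1)) / (x + 1)"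
      using x by (intro divide_right_mono) (auto simp: algebra_simps)
    \<comment> \<open>After cross-multiplication the terms linear in \<open>e\<close> cancel; only
      nonpositive terms of second order remain.\<close>
    also have "\<dots> \<le> (1 - e * L) / (x + 1 + e)"
    proof -
      have "(1 - e * L - e / (x + 1)) * (x + 1 + e) \<le> (1 - e * L) * (x + 1)"
      proof -
        have "(1 - e * L - e / (x + 1)) * (x + 1 + e) - (1 - e * L) * (x + 1)
          = - (e * L * e) - e * e / (x + 1)"
          using x by (simp add: field_simps)
        also have "\<dots> \<le> 0" using eL assms x by (smt (verit) divide_nonneg_nonneg mult_nonneg_nonneg)
        finally show ?thesis by simp
      qed
      then show ?thesis using x assms by (simp add: divide_simps)
    qed
    also have "\<dots> = (1 - e * L) / x * (x / (x + 1 + e))" using x by simp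
    also have "\<dots> \<le> ?P * (x / (x + 1 + e))"
      using Suc x assms by (intro mult_right_mono) (auto simp: L_def x_def)
    finally show ?thesis .
  qed
  show ?case using goal S by (simp add: x_def add_ac)
qed simp

text \<open>Lets errors of order \<open>1/n\<close> be absorbed into
  \<open>ln n / n\<close>.\<close>

lemma one_le_two_ln:
  assumes "n \<ge> 2"
  shows "1 \<le> 2 * ln (real n)"
proof -
  have "ln (1 / real n) \<le> 1 / real n - 1" using assms by (intro ln_le_minus_one) auto
  moreover have "1 / real n \<le> 1 / 2" using assms by (intro divide_left_mono) auto
  moreover have "ln (1 / real n) = - ln (real n)" using assms by (simp add: ln_div)
  ultimately show ?thesis by linarith
qed

text \<open>For \<open>z = 1 - 1/n\<close> the prefactor is \<open>n\<close> and
  \<open>n (1/z - 1) = 1 + 1/(n - 1)\<close>, a small perturbation of the telescoping case. The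
  constant 6 is 4 from the perturbation plus 2 from replacing \<open>n/(n + 1)\<close> by 1.\<close>

lemma suminf_cover_prob_ge:
  assumes n: "n \<ge> 2"
  shows "(\<Sum>m. (1 - 1 / real n) ^ m * cover_prob n m n) \<ge> 1 - 6 * ln (real n) / real n"
proof -
  define z where "z = 1 - 1 / real n"
  define e where "e = 1 / (real n - 1)"
  have z: "0 < z" "z < 1" using n by (auto simp: z_def)
  have iz: "real n * (1 / z - 1) = 1 + e" using n by (simp add: z_def e_def field_simps)
  have e: "e \<ge> 0" "e \<le> 2 / real n" using n by (auto simp: e_def field_simps)
  have ln2: "ln (real n + 1) \<le> 2 * ln (real n)"
  proof -
    have "real n * 2 \<le> real n * real n" using n by (intro mult_left_mono) auto
    moreover have "real n \<ge> 2" using n by simp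
    ultimately have "real n + 1 \<le> real n ^ 2" unfolding power2_eq_square by linarith
    then have "ln (real n + 1) \<le> ln (real n ^ 2)" using n by (intro ln_mono) auto
    then show ?thesis using n by (simp add: ln_realpow)
  qed
  have ln1: "1 \<le> 2 * ln (real n)" using n by (rule one_le_two_ln)
  have "1 - 6 * ln (real n) / real n \<le> (1 - 4 * ln (real n) / real n) - 1 / real n"
    using ln1 n by (simp add: field_simps)
  also have "\<dots> \<le> (1 - e * ln (real n + 1)) - 1 / real n"
  proof -
    have "e * ln (real n + 1) \<le> 2 / real n * (2 * ln (real n))"
      using e ln2 n by (intro mult_mono) auto
    then show ?thesis by simp
  qed
  also have "\<dots> \<le> (1 - e * ln (real n + 1)) * (real n / (real n + 1))"
  proof -
    have "e * ln (real n + 1) \<ge> 0" using e by simp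
    then have "(1 - e * ln (real n + 1)) * (1 - real n / (real n + 1)) \<le> 1 * (1 - real n / (real n + 1))"
      using n by (intro mult_right_mono) auto
    also have "\<dots> \<le> 1 / real n" using n by (simp add: field_simps)
    finally show ?thesis by (simp add: algebra_simps)
  qed
  also have "\<dots> = real n * ((1 - e * ln (real n + 1)) / (real n + 1))" by simp
  also have "\<dots> \<le> real n * (\<Prod>k=1..n. real k / (real k + (1 + e)))"
    using prod_ratio_ge[OF e(1), of n] by (intro mult_left_mono) auto
  also have "\<dots> = (\<Sum>m. z ^ m * cover_prob n m n)"
    unfolding suminf_cover_prob[OF order_refl z] iz using n by (simp add: z_def)
  finally show ?thesis by (simp add: z_def)
qed

section \<open>The law of the completion time\<close>

context
  fixes n :: nat
  assumes n: "n \<ge> 1"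
begin

lemma prob_space_coupon_space: "prob_space (coupon_space n)"
  unfolding coupon_space_def by (intro prob_space.prob_space_stream_space prob_space_measure_pmf)

lemma space_coupon_space [simp]: "space (coupon_space n) = UNIV"
  by (simp add: coupon_space_def space_stream_space)

definition covered :: "nat set \<Rightarrow> nat \<Rightarrow> nat stream set" where
  "covered A m = {\<omega>. A \<subseteq> (\<lambda>i. \<omega> !! i) ` {..<m}}"

lemma sets_covered:
  assumes "finite A"
  shows "covered A m \<in> sets (coupon_space n)"
proof -
  have eq: "covered A m = {\<omega>\<in>space (coupon_space n). \<forall>a\<in>A. \<exists>i\<in>{..<m}. \<omega> !! i = a}"
    by (auto simp: covered_def)
  show ?thesis
    unfolding eq coupon_space_def using assms by measurable
qed

text \<open>Conditioning on the first draw \<open>t\<close> leaves \<open>A - {t}\<close> to be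
  covered by the shifted stream; \<open>card A\<close> of the \<open>n\<close> values of
  \<open>t\<close> remove an element. This is the recursion of \<open>cover_prob\<close>.\<close>

lemma prob_covered:
  "A \<subseteq> {..<n} \<Longrightarrow> measure (coupon_space n) (covered A m) = cover_prob n m (card A)"
proof (induction m arbitrary: A)
  case 0
  interpret C: prob_space "coupon_space n" by (rule prob_space_coupon_space)
  have "finite A" using 0 by (rule finite_subset) simp
  then show ?case using C.prob_space by (auto simp: covered_def)
next
  case (Suc m)
  interpret C: prob_space "coupon_space n" by (rule prob_space_coupon_space)
  have fin: "finite A" using Suc.prems by (rule finite_subset) simp
  have ne: "{..<n} \<noteq> {}" using n by (simp add: lessThan_empty_iff)
  have shift: "{x \<in> space (coupon_space n). t ## x \<in> covered A (Suc m)} = covered (A - {t}) m" for t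
  proof -
    have "(\<lambda>i. (t ## x) !! i) ` {..<Suc m} = insert t ((\<lambda>i. x !! i) ` {..<m})" for x
      by (simp add: lessThan_Suc_eq_insert_0 image_image)
    then show ?thesis by (auto simp: covered_def)
  qed
  have "emeasure (coupon_space n) (covered A (Suc m))
      = (\<integral>\<^sup>+t. emeasure (coupon_space n) (covered (A - {t}) m) \<partial>measure_pmf (pmf_of_set {..<n}))"
    using prob_space.emeasure_stream_space[OF prob_space_measure_pmf[of "pmf_of_set {..<n}"], of "covered A (Suc m)"] sets_covered[OF fin, of "Suc m"]
    unfolding coupon_space_def[symmetric] shift by simp
  also have "\<dots> = (\<integral>\<^sup>+t. ennreal (cover_prob n m (card (A - {t}))) \<partial>measure_pmf (pmf_of_set {..<n}))"
  proof (intro nn_integral_cong)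
    fix t
    have "A - {t} \<subseteq> {..<n}" using Suc.prems by auto
    from Suc.IH[OF this] show "emeasure (coupon_space n) (covered (A - {t}) m) = ennreal (cover_prob n m (card (A - {t})))"
      by (simp add: C.emeasure_eq_measure)
  qed
  also have "\<dots> = ennreal (\<integral>t. cover_prob n m (card (A - {t})) \<partial>measure_pmf (pmf_of_set {..<n}))"
  proof (intro nn_integral_eq_integral integrable_measure_pmf_finite AE_I2)
    fix t
    have "card (A - {t}) \<le> n"
      using card_mono[of "{..<n}" "A - {t}"] Suc.prems by auto
    then show "0 \<le> cover_prob n m (card (A - {t}))" using cover_prob_bounds by blast
  qed (use ne in simp)
  also have "(\<integral>t. cover_prob n m (card (A - {t})) \<partial>measure_pmf (pmf_of_set {..<n}))
      = (\<Sum>t<n. cover_prob n m (card (A - {t}))) / real n"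
    using ne by (simp add: integral_pmf_of_set)
  also have "(\<Sum>t<n. cover_prob n m (card (A - {t})))
      = (\<Sum>t\<in>{..<n} - A. cover_prob n m (card A)) + (\<Sum>t\<in>A. cover_prob n m (card A - 1))"
    using Suc.prems fin
    by (subst sum.subset_diff[of A]) (auto intro!: arg_cong2[of _ _ _ _ "(+)"] sum.cong)
  also have "\<dots> = (real n - real (card A)) * cover_prob n m (card A) + real (card A) * cover_prob n m (card A - 1)"
    using Suc.prems fin card_mono[of "{..<n}" A] by (simp add: card_Diff_subset of_nat_diff)
  also have "\<dots> / real n = cover_prob n (Suc m) (card A)"
    using n by (simp add: add_divide_distrib diff_divide_distrib left_diff_distrib)
  finally show ?case
    using card_mono[of "{..<n}" A] Suc.prems cover_prob_bounds[of "card A" n "Suc m"]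
    by (simp add: C.emeasure_eq_measure del: cover_prob.simps)
qed

lemma covered_mono: "m \<le> m' \<Longrightarrow> covered A m \<subseteq> covered A m'"
  unfolding covered_def by fastforce

text \<open>On a stream that misses a coupon forever, the \<open>LEAST\<close> in
  \<open>coupon_T\<close> is an unspecified number; such streams form a null set.\<close>

lemma AE_covered: "AE \<omega> in coupon_space n. \<exists>m. \<omega> \<in> covered {..<n} m"
proof -
  interpret C: prob_space "coupon_space n" by (rule prob_space_coupon_space)
  have sets: "(\<Union>m. covered {..<n} m) \<in> sets (coupon_space n)"
    using sets_covered by auto
  have "1 - real n * (1 - 1 / real n) ^ m \<le> C.prob (\<Union>m. covered {..<n} m)" for m
  proof -
    have "1 - real n * (1 - 1 / real n) ^ m \<le> C.prob (covered {..<n} m)"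
      using cover_prob_ge[OF n order_refl] by (simp add: prob_covered)
    also have "\<dots> \<le> C.prob (\<Union>m. covered {..<n} m)"
      using sets by (intro C.finite_measure_mono) auto
    finally show ?thesis .
  qed
  moreover have "(\<lambda>m. 1 - real n * (1 - 1 / real n) ^ m) \<longlonglongrightarrow> 1 - real n * 0"
    using n by (intro tendsto_intros LIMSEQ_power_zero) auto
  ultimately have "1 - real n * 0 \<le> C.prob (\<Union>m. covered {..<n} m)"
    by (intro LIMSEQ_le_const2) auto
  then have "C.prob (\<Union>m. covered {..<n} m) = 1" using C.prob_le_1 by (simp add: antisym)
  then have "AE \<omega> in coupon_space n. \<omega> \<in> (\<Union>m. covered {..<n} m)"
    using sets C.prob_eq_1 by blast
  then show ?thesis by simp
qed

lemma measurable_coupon_T: "coupon_T n \<in> measurable (coupon_space n) (count_space UNIV)"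
proof -
  have "Measurable.pred (coupon_space n) (\<lambda>\<omega>. {..<n} \<subseteq> (\<lambda>i. \<omega> !! i) ` {..<m})" for m
    using sets_covered[of "{..<n}" m] by (simp add: pred_def covered_def)
  then show ?thesis unfolding coupon_T_def by (intro measurable_Least)
qed

text \<open>The event of completion at time \<open>m + 1\<close> is
  \<open>covered {..<n} (m + 1)\<close> minus \<open>covered {..<n} m\<close>. Boundedness of
  \<open>v\<close> justifies exchanging sum and integral.\<close>

lemma expectation_coupon_T:
  fixes v :: "nat \<Rightarrow> real"
  assumes v: "\<And>m. \<bar>v m\<bar> \<le> B"
  shows "(\<lambda>m. (cover_prob n (Suc m) n - cover_prob n m n) * v (Suc m)) sums (\<integral>\<omega>. v (coupon_T n \<omega>) \<partial>coupon_space n)"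
proof -
  interpret C: prob_space "coupon_space n" by (rule prob_space_coupon_space)
  define E where "E m = covered {..<n} m" for m
  have E: "E m \<in> sets (coupon_space n)" for m by (simp add: E_def sets_covered)
  define p where "p m = cover_prob n (Suc m) n - cover_prob n m n" for m
  have pE: "C.prob (E (Suc m) - E m) = p m" for m
    using E covered_mono[of m "Suc m"]
    by (subst C.finite_measure_Diff) (auto simp: E_def p_def prob_covered simp del: cover_prob.simps)
  have p0: "p m \<ge> 0" for m unfolding pE[symmetric] by simp
  define f where "f m \<omega> = v (Suc m) * indicator (E (Suc m) - E m) \<omega>" for m \<omega>
  have int: "integrable (coupon_space n) (f m)" for m
    unfolding f_def using E by (intro integrable_mult_right integrable_real_indicator) (auto simp: C.emeasure_eq_measure)
  have If: "(\<integral>\<omega>. f m \<omega> \<partial>coupon_space n) = p m * v (Suc m)" for m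
    unfolding f_def using E by (simp add: pE)
  have normf: "(\<integral>\<omega>. norm (f m \<omega>) \<partial>coupon_space n) = p m * \<bar>v (Suc m)\<bar>" for m
    unfolding f_def using E by (simp add: abs_mult pE)
  have fsums: "(\<lambda>m. f m \<omega>) sums v (coupon_T n \<omega>) \<and> summable (\<lambda>m. norm (f m \<omega>))"
    if ex: "\<exists>m. \<omega> \<in> covered {..<n} m" for \<omega>
  proof -
    have T: "\<omega> \<in> E m \<longleftrightarrow> coupon_T n \<omega> \<le> m" for m
    proof
      assume "coupon_T n \<omega> \<le> m"
      moreover have "\<omega> \<in> E (coupon_T n \<omega>)"
        using LeastI_ex[OF ex] by (simp add: E_def coupon_T_def covered_def)
      ultimately show "\<omega> \<in> E m" using covered_mono unfolding E_def by blast
    qed (auto simp: E_def covered_def coupon_T_def intro: Least_le)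
    \<comment> \<open>Since \<open>n \<ge> 1\<close>, completion takes at least one draw, so a
      series indexed by \<open>Suc m\<close> misses no value.\<close>
    have "\<omega> \<notin> E 0" using n by (auto simp: E_def covered_def lessThan_empty_iff)
    then obtain k where k: "coupon_T n \<omega> = Suc k" using T[of 0] by (cases "coupon_T n \<omega>") auto
    have f: "f m \<omega> = (if m = k then v (coupon_T n \<omega>) else 0)" for m
      by (auto simp: f_def T k)
    show ?thesis
      unfolding f using sums_single[of k "\<lambda>_. v (coupon_T n \<omega>)"]
      by (auto intro!: summable_finite[of "{k}"] split: if_splits)
  qed
  have psums: "summable p"
  proof (rule summableI_nonneg_bounded[OF p0])
    show "(\<Sum>m<N. p m) \<le> 1" for N
      using cover_prob_bounds[of n n N] n sum_lessThan_telescope[of "\<lambda>m. cover_prob n m n" N]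
      by (simp add: p_def del: cover_prob.simps(2))
  qed
  have sumnorm: "summable (\<lambda>m. \<integral>\<omega>. norm (f m \<omega>) \<partial>coupon_space n)"
  proof (rule summable_comparison_test'[where N = 0])
    show "summable (\<lambda>m. p m * B)" using psums by (rule summable_mult2)
    show "norm (\<integral>\<omega>. norm (f m \<omega>) \<partial>coupon_space n) \<le> p m * B" for m
      unfolding normf using p0 v by (auto simp: abs_mult intro!: mult_left_mono)
  qed
  have AE: "AE \<omega> in coupon_space n. summable (\<lambda>m. norm (f m \<omega>))"
    using AE_covered by eventually_elim (use fsums in blast)
  have "(\<integral>\<omega>. v (coupon_T n \<omega>) \<partial>coupon_space n) = (\<integral>\<omega>. (\<Sum>m. f m \<omega>) \<partial>coupon_space n)"
  proof (intro integral_cong_AE)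
    show "(\<lambda>\<omega>. v (coupon_T n \<omega>)) \<in> borel_measurable (coupon_space n)"
      using measurable_coupon_T by (rule measurable_compose) simp
    show "(\<lambda>\<omega>. \<Sum>m. f m \<omega>) \<in> borel_measurable (coupon_space n)"
      using int by (intro borel_measurable_suminf) auto
    show "AE \<omega> in coupon_space n. v (coupon_T n \<omega>) = (\<Sum>m. f m \<omega>)"
      using AE_covered by eventually_elim (use fsums sums_unique in blast)
  qed
  then show ?thesis
    using sums_integral[OF int AE sumnorm] unfolding If by (simp add: p_def del: cover_prob.simps)
qed

end

section \<open>Functions with an almost everywhere Lipschitz derivative\<close>

text \<open>Difference quotients of \<open>h\<close> integrate exactly by means of an antiderivative of \<open>h\<close>; dominated
  convergence then gives the fundamental theorem of calculus for \<open>h\<close> without absolute continuity.\<close>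
lemma lipschitz_AE_derivative:
  fixes h g :: "real \<Rightarrow> real"
  assumes lip: "L-lipschitz_on UNIV h" and cont: "continuous_on UNIV g"
    and AE: "AE x in lborel. (h has_real_derivative g x) (at x)"
  shows "(h has_real_derivative g x) (at x)"
proof -
  have conth: "continuous_on UNIV h" using lip by (rule lipschitz_on_continuous_on)
  obtain H where H: "\<And>x. (H has_real_derivative h x) (at x)"
    using einterval_antiderivative[of "-\<infinity>" "\<infinity>" h] conth
    by (auto simp: continuous_on_eq_continuous_at has_real_derivative_iff_has_vector_derivative)
  obtain G where G: "\<And>x. (G has_real_derivative g x) (at x)"
    using einterval_antiderivative[of "-\<infinity>" "\<infinity>" g] cont
    by (auto simp: continuous_on_eq_continuous_at has_real_derivative_iff_has_vector_derivative)
  have [measurable]: "h \<in> borel_measurable borel" "g \<in> borel_measurable borel"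
    using conth cont by (auto intro: borel_measurable_continuous_onI)
  define e where "e k = inverse (real (Suc k))" for k
  have e: "e k > 0" for k by (simp add: e_def)
  have e_lim: "filterlim e (at 0) sequentially"
    unfolding filterlim_at e_def using LIMSEQ_inverse_real_of_nat by auto
  have quot: "(\<lambda>k. (F (x + e k) - F x) / e k) \<longlonglongrightarrow> D"
    if "(F has_real_derivative D) (at x)" for F :: "real \<Rightarrow> real" and D x
    using filterlim_compose[OF that[unfolded DERIV_def] e_lim] by simp
  have eq: "h b - h a = G b - G a" if "a \<le> b" for a b
  proof -
    define s where "s k x = indicator {a..b} x * ((h (x + e k) - h x) / e k)" for k x
    have [measurable]: "s k \<in> borel_measurable borel" for k unfolding s_def by measurable
    have "(\<lambda>k. \<integral>x. s k x \<partial>lborel) \<longlonglongrightarrow> (\<integral>x. indicator {a..b} x * g x \<partial>lborel)"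
    proof (rule integral_dominated_convergence)
      show "integrable lborel (\<lambda>x. L * indicator {a..b} x)"
        using that by (intro integrable_mult_right integrable_real_indicator) auto
      show "AE x in lborel. (\<lambda>k. s k x) \<longlonglongrightarrow> indicator {a..b} x * g x"
        using AE
      proof eventually_elim
        case (elim x)
        then show ?case unfolding s_def by (intro tendsto_mult_left quot)
      qed
      show "AE x in lborel. norm (s k x) \<le> L * indicator {a..b} x" for k
      proof (rule AE_I2)
        fix x
        have "\<bar>h (x + e k) - h x\<bar> \<le> L * e k"
          using lipschitz_onD[OF lip, of "x + e k" x] e[of k] by (simp add: dist_real_def)
        then show "norm (s k x) \<le> L * indicator {a..b} x"
          using e[of k] by (auto simp: s_def abs_mult divide_le_eq split: split_indicator)
      qed
    qed auto
    moreover have "(\<integral>x. s k x \<partial>lborel) = (H (b + e k) - H b) / e k - (H (a + e k) - H a) / e k" for k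
    proof -
      have "((\<lambda>x. (H (x + e k) - H x) / e k) has_real_derivative (h (x + e k) - h x) / e k) (at x)" for x
        using H[of "x + e k", unfolded DERIV_shift] H[of x]
        by (intro DERIV_cdivide DERIV_diff)
      then have "(\<integral>x. indicator {a..b} x *\<^sub>R ((h (x + e k) - h x) / e k) \<partial>lborel)
          = (H (b + e k) - H b) / e k - (H (a + e k) - H a) / e k"
        using that
      proof (intro integral_FTC_atLeastAtMost[where F = "\<lambda>x. (H (x + e k) - H x) / e k", THEN trans])
        show "continuous_on {a..b} (\<lambda>x. (h (x + e k) - h x) / e k)"
          using e[of k] by (intro continuous_intros continuous_on_compose2[OF conth]) auto
      qed (auto simp: has_real_derivative_iff_has_vector_derivative[symmetric]
          intro: has_field_derivative_at_within)
      then show ?thesis by (simp add: s_def)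
    qed
    moreover have "(\<lambda>k. (H (b + e k) - H b) / e k - (H (a + e k) - H a) / e k) \<longlonglongrightarrow> h b - h a"
      by (intro tendsto_diff quot H)
    moreover have "(\<integral>x. indicator {a..b} x * g x \<partial>lborel) = G b - G a"
      using integral_FTC_atLeastAtMost[of a b G g] G that cont
      by (auto simp: has_real_derivative_iff_has_vector_derivative[symmetric]
            intro: has_field_derivative_at_within continuous_on_subset)
    ultimately show ?thesis using LIMSEQ_unique by simp
  qed
  \<comment> \<open>Equal increments make \<open>h\<close> a translate of the antiderivative
    \<open>G\<close>, hence differentiable everywhere.\<close>
  define c where "c = h 0 - G 0"
  have "h = (\<lambda>x. G x + c)"
  proof
    show "h x = G x + c" for x
      using eq[of 0 x] eq[of x 0] by (cases "0 \<le> x") (auto simp: c_def)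
  qed
  then show ?thesis using DERIV_add[OF G[of x] DERIV_const[of c]] by simp
qed

lemma lipschitz_derivative_bound:
  fixes h :: "real \<Rightarrow> real"
  assumes lip: "L-lipschitz_on UNIV h" and D: "(h has_real_derivative D) (at x)"
  shows "\<bar>D\<bar> \<le> L"
proof (rule tendsto_upperbound)
  show "((\<lambda>d. \<bar>(h (x + d) - h x) / d\<bar>) \<longlongrightarrow> \<bar>D\<bar>) (at 0)"
    using D[unfolded DERIV_def] by (rule tendsto_rabs)
  show "\<forall>\<^sub>F d in at 0. \<bar>(h (x + d) - h x) / d\<bar> \<le> L"
    using lipschitz_onD[OF lip, of "x + _" x]
    by (auto simp: eventually_at_filter dist_real_def divide_le_eq)
qed simp

lemma Lip2_derivative:
  assumes "Lip2 h"
  obtains g K L where "\<And>x. (h has_real_derivative g x) (at x)"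
    "K-lipschitz_on UNIV g" "\<And>x. \<bar>g x\<bar> \<le> L" "L-lipschitz_on UNIV h"
proof -
  from assms obtain g K L where gKL: "L-lipschitz_on UNIV h" "K-lipschitz_on UNIV g"
    "AE x in lborel. (h has_real_derivative g x) (at x)"
    unfolding Lip2_def by blast
  have "(h has_real_derivative g x) (at x)" for x
    using lipschitz_AE_derivative[OF gKL(1) lipschitz_on_continuous_on[OF gKL(2)] gKL(3)] .
  then show ?thesis using that[of g K L] gKL lipschitz_derivative_bound by blast
qed

section \<open>The Gumbel semigroup\<close>

text \<open>The density has the antiderivative \<open>exp (- exp (- x))\<close>, which tends to 0 at
  minus infinity and to 1 at infinity. An extended real endpoint \<open>c\<close> handles both
  claims at once.\<close>

lemma emeasure_gumbel_lessThan:
  "emeasure gumbel {..<b} = ennreal (exp (- exp (- b)))" (is ?thesis1)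
  and emeasure_gumbel_UNIV: "emeasure gumbel UNIV = 1" (is ?thesis2)
proof -
  let ?d = "\<lambda>x::real. exp (- (x + exp (- x)))" and ?F = "\<lambda>x::real. exp (- exp (- x))"
  have emeas: "emeasure gumbel (einterval (-\<infinity>) c) = ennreal B"
    if c: "-\<infinity> < c" and B: "((?F \<circ> real_of_ereal) \<longlongrightarrow> B) (at_left c)" for c B
  proof -
    have DF: "(?F has_real_derivative ?d x) (at x)" for x
      by (auto intro!: derivative_eq_intros simp: mult_exp_exp add.commute)
    have lim: "((?F \<circ> real_of_ereal) \<longlongrightarrow> 0) (at_right (-\<infinity>))"
      unfolding ereal_tendsto_simps by real_asymp
    have int: "set_integrable lborel (einterval (-\<infinity>) c) ?d"
      by (rule interval_integral_FTC_nonneg(1)[OF c DF _ _ lim B]) (auto intro!: continuous_intros)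
    have val: "(LBINT x=-\<infinity>..c. ?d x) = B - 0"
      by (rule interval_integral_FTC_nonneg(2)[OF c DF _ _ lim B]) (auto intro!: continuous_intros)
    have "emeasure gumbel (einterval (-\<infinity>) c)
        = (\<integral>\<^sup>+x. ennreal (indicator (einterval (-\<infinity>) c) x * ?d x) \<partial>lborel)"
      unfolding gumbel_def
      by (subst emeasure_density) (auto intro!: nn_integral_cong split: split_indicator)
    also have "\<dots> = ennreal (\<integral>x. indicator (einterval (-\<infinity>) c) x * ?d x \<partial>lborel)"
      using int by (intro nn_integral_eq_integral) (auto simp: set_integrable_def)
    also have "(\<integral>x. indicator (einterval (-\<infinity>) c) x * ?d x \<partial>lborel) = B"
      using val c by (simp add: interval_lebesgue_integral_def set_lebesgue_integral_def)
    finally show ?thesis .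
  qed
  have "isCont ?F b" by (intro continuous_intros)
  then have "(?F \<longlongrightarrow> ?F b) (at_left b)"
    unfolding isCont_def by (rule filterlim_mono[OF _ order_refl]) (simp add: at_le)
  then have "((?F \<circ> real_of_ereal) \<longlongrightarrow> ?F b) (at_left (ereal b))"
    unfolding ereal_tendsto_simps .
  moreover have "einterval (-\<infinity>) (ereal b) = {..<b}" by (auto simp: einterval_def)
  ultimately show ?thesis1 using emeas[of "ereal b"] by simp
  have "((?F \<circ> real_of_ereal) \<longlongrightarrow> 1) (at_left \<infinity>)"
    unfolding ereal_tendsto_simps by real_asymp
  from emeas[OF _ this] show ?thesis2 by (simp add: einterval_def)
qed

lemma space_gumbel [simp]: "space gumbel = UNIV" and sets_gumbel [simp, measurable_cong]: "sets gumbel = sets borel"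
  by (simp_all add: gumbel_def)

interpretation gumbel: prob_space gumbel
  by standard (simp add: emeasure_gumbel_UNIV)

lemma gumbel_prob_lessThan: "measure gumbel {..<b} = exp (- exp (- b))"
  by (simp add: measure_def emeasure_gumbel_lessThan)

text \<open>For \<open>z \<ge> 0\<close> the density is at most \<open>exp (- z)\<close>. Only the
  positive part matters later, because the maximum in \<open>P0\<close> cuts off the lower
  tail.\<close>

lemma integrable_gumbel_pos: "integrable gumbel (\<lambda>z. max 0 z)"
proof -
  have "integrable lborel (\<lambda>z::real. exponential_density 1 z * z ^ 1)"
  proof (rule integrableI_nonneg)
    show "(\<integral>\<^sup>+z. ennreal (exponential_density 1 z * z ^ 1) \<partial>lborel) < \<infinity>"
      by (subst nn_integral_erlang_ith_moment) auto
  qed (auto simp: exponential_density_def)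
  then have "integrable lborel (\<lambda>z::real. exp (- (z + exp (- z))) *\<^sub>R max 0 z)"
    by (rule Bochner_Integration.integrable_bound)
      (auto simp: exponential_density_def abs_mult intro!: AE_I2 mult_right_mono)
  then show ?thesis
    unfolding gumbel_def by (subst integrable_density) auto
qed

lemma integrable_gumbel_max:
  fixes h :: "real \<Rightarrow> real"
  assumes lip: "L-lipschitz_on UNIV h"
  shows "integrable gumbel (\<lambda>z. h (max a (z + c)))"
proof (rule Bochner_Integration.integrable_bound)
  have L: "L \<ge> 0" using lip by (rule lipschitz_on_nonneg)
  show "integrable gumbel (\<lambda>z. \<bar>h a\<bar> + L * (max 0 z + \<bar>c - a\<bar>))"
    using integrable_gumbel_pos by auto
  have [measurable]: "h \<in> borel_measurable borel"
    using lip by (intro borel_measurable_continuous_onI lipschitz_on_continuous_on)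
  show "(\<lambda>z. h (max a (z + c))) \<in> borel_measurable gumbel" by measurable
  show "AE z in gumbel. norm (h (max a (z + c))) \<le> norm (\<bar>h a\<bar> + L * (max 0 z + \<bar>c - a\<bar>))"
  proof (rule AE_I2)
    fix z
    have "\<bar>h (max a (z + c)) - h a\<bar> \<le> L * \<bar>max a (z + c) - a\<bar>"
      using lipschitz_onD[OF lip, of "max a (z + c)" a] by (simp add: dist_real_def)
    also have "\<dots> \<le> L * (max 0 z + \<bar>c - a\<bar>)" using L by (intro mult_left_mono) auto
    finally show "norm (h (max a (z + c))) \<le> norm (\<bar>h a\<bar> + L * (max 0 z + \<bar>c - a\<bar>))" by simp
  qed
qed

text \<open>For \<open>t > 0\<close> the maximum depends on \<open>x\<close> only where
  \<open>z + c < x - t\<close>; there the derivative is \<open>g (x - t)\<close>, and the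
  exponential factor is the Gumbel probability of this event. At \<open>t = 0\<close> the factor is
  1.\<close>

lemma P0_has_derivative:
  fixes h g :: "real \<Rightarrow> real"
  assumes lip: "L-lipschitz_on UNIV h" and D: "\<And>x. (h has_real_derivative g x) (at x)"
    and t: "t \<ge> 0"
  shows "(P0 t h has_real_derivative g (x - t) * exp (- (exp t - 1) * exp (- x))) (at x)"
proof (cases "t = 0")
  case True
  then show ?thesis using D by (simp add: P0_def[abs_def])
next
  case False
  define c where "c = ln (1 - exp (- t))"
  define a where "a = x - t"
  have P: "P0 t h y = (\<integral>z. h (max (y - t) (z + c)) \<partial>gumbel)" for y
    using False by (simp add: P0_def c_def)
  have [measurable]: "h \<in> borel_measurable borel"
    using lip by (intro borel_measurable_continuous_onI lipschitz_on_continuous_on)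
  have L: "L \<ge> 0" using lip by (rule lipschitz_on_nonneg)
  have "exp (- (a - c)) = exp (- x) * exp t * exp c"
    by (simp add: a_def mult_exp_exp)
  also have "exp c = 1 - exp (- t)" using False t by (simp add: c_def)
  also have "exp (- x) * exp t * (1 - exp (- t)) = (exp t - 1) * exp (- x)"
    by (simp add: algebra_simps exp_minus)
  finally have prob: "measure gumbel {..<a - c} = exp (- (exp t - 1) * exp (- x))"
    unfolding gumbel_prob_lessThan by (simp only: minus_mult_left)
  have "((\<lambda>d. (P0 t h (x + d) - P0 t h x) / d) \<longlongrightarrow> g a * measure gumbel {..<a - c}) (at 0)"
    unfolding tendsto_at_iff_sequentially
  proof (intro allI impI)
    fix X :: "nat \<Rightarrow> real"
    assume X0: "\<forall>i. X i \<in> UNIV - {0}" and X: "X \<longlonglongrightarrow> 0"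
    define Q where "Q k z = (h (max (a + X k) (z + c)) - h (max a (z + c))) / X k" for k z
    have aX: "(\<lambda>k. a + X k) \<longlonglongrightarrow> a" using tendsto_add[OF tendsto_const X, of a] by simp
    have X_at: "filterlim X (at 0) sequentially"
      unfolding filterlim_at using X X0 by auto
    have "(\<lambda>k. \<integral>z. Q k z \<partial>gumbel) \<longlonglongrightarrow> (\<integral>z. g a * indicator {..<a - c} z \<partial>gumbel)"
    proof (rule integral_dominated_convergence)
      show "integrable gumbel (\<lambda>z. L)" by simp
      show "AE z in gumbel. norm (Q k z) \<le> L" for k
      proof (rule AE_I2)
        fix z
        have "\<bar>h (max (a + X k) (z + c)) - h (max a (z + c))\<bar> \<le> L * \<bar>max (a + X k) (z + c) - max a (z + c)\<bar>"
          using lipschitz_onD[OF lip] by (simp add: dist_real_def)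
        also have "\<dots> \<le> L * \<bar>X k\<bar>" using L by (intro mult_left_mono) auto
        finally show "norm (Q k z) \<le> L" using X0 by (simp add: Q_def divide_le_eq)
      qed
      \<comment> \<open>The maximum has its kink at \<open>z = a - c\<close>, a null set; elsewhere
        the quotients converge.\<close>
      have "AE z in lborel. z \<noteq> a - c" by (rule AE_lborel_singleton)
      then have "AE z in gumbel. z \<noteq> a - c"
        unfolding gumbel_def by (subst AE_density) auto
      then show "AE z in gumbel. (\<lambda>k. Q k z) \<longlonglongrightarrow> g a * indicator {..<a - c} z"
      proof eventually_elim
        case (elim z)
        show ?case
        proof (cases "z + c < a")
          case True
          have "\<forall>\<^sub>F k in sequentially. z + c < a + X k" using order_tendstoD(1)[OF aX True] .
          then have "\<forall>\<^sub>F k in sequentially. (h (a + X k) - h a) / X k = Q k z"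
            by eventually_elim (use True in \<open>simp add: Q_def max_def\<close>)
          moreover have "(\<lambda>k. (h (a + X k) - h a) / X k) \<longlonglongrightarrow> g a"
            using filterlim_compose[OF D[of a, unfolded DERIV_def] X_at] by simp
          ultimately show ?thesis using True by (auto elim: Lim_transform_eventually)
        next
          case False
          then have "a < z + c" using elim by simp
          then have "\<forall>\<^sub>F k in sequentially. a + X k < z + c" using order_tendstoD(2)[OF aX] by blast
          then have "\<forall>\<^sub>F k in sequentially. 0 = Q k z"
            by eventually_elim (use False in \<open>simp add: Q_def max_def\<close>)
          then show ?thesis using False by (auto intro: Lim_transform_eventually[OF tendsto_const])
        qed
      qed
    qed (auto simp: Q_def)
    moreover have "(\<integral>z. Q k z \<partial>gumbel) = (P0 t h (x + X k) - P0 t h x) / X k" for k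
    proof -
      have "P0 t h (x + X k) - P0 t h x = (\<integral>z. h (max (a + X k) (z + c)) - h (max a (z + c)) \<partial>gumbel)"
        unfolding P by (subst Bochner_Integration.integral_diff)
          (auto intro!: integrable_gumbel_max[OF lip] simp: a_def algebra_simps)
      then show ?thesis by (simp add: Q_def)
    qed
    moreover have "(\<integral>z. g a * indicator {..<a - c} z \<partial>gumbel) = g a * measure gumbel {..<a - c}"
      by simp
    ultimately show "((\<lambda>d. (P0 t h (x + d) - P0 t h x) / d) \<circ> X) \<longlonglongrightarrow> g a * measure gumbel {..<a - c}"
      by (simp add: o_def)
  qed
  then show ?thesis unfolding DERIV_def prob by (simp add: a_def)
qed

text \<open>The derivative is \<open>w * exp (- w)\<close> with \<open>w = b * exp (- x)\<close>,
  hence at most 1 whatever \<open>b\<close> is. This makes the later bounds uniform in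
  \<open>t\<close>.\<close>

lemma double_exp_lipschitz:
  fixes b :: real
  assumes "b \<ge> 0"
  shows "\<bar>exp (- b * exp (- x)) - exp (- b * exp (- y))\<bar> \<le> \<bar>x - y\<bar>"
proof -
  let ?f = "\<lambda>x. exp (- b * exp (- x))"
  have "norm (?f x - ?f y) \<le> 1 * norm (x - y)"
  proof (rule field_differentiable_bound[of UNIV])
    show "(?f has_field_derivative b * exp (- z) * exp (- (b * exp (- z)))) (at z within UNIV)" for z
      by (auto intro!: derivative_eq_intros)
    have "w \<le> exp w" for w :: real using exp_ge_add_one_self[of w] by linarith
    then have "w * exp (- w) \<le> 1" for w :: real by (simp add: exp_minus field_simps)
    then show "norm (b * exp (- z) * exp (- (b * exp (- z)))) \<le> 1" for z
      using assms by (simp add: abs_mult)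
  qed auto
  then show ?thesis by simp
qed

lemma P0_derivative_bounds:
  fixes g :: "real \<Rightarrow> real"
  assumes lip: "K-lipschitz_on UNIV g" and bd: "\<And>x. \<bar>g x\<bar> \<le> L" and t: "t \<ge> 0"
  defines "u \<equiv> \<lambda>x. g (x - t) * exp (- (exp t - 1) * exp (- x))"
  shows "\<bar>u x\<bar> \<le> L" and "\<bar>u x - u y\<bar> \<le> (K + L) * \<bar>x - y\<bar>"
proof -
  define E where "E x = exp (- (exp t - 1) * exp (- x))" for x
  have b: "exp t - 1 \<ge> 0" using t by simp
  have E: "0 \<le> E x" "E x \<le> 1" for x
    using mult_nonneg_nonneg[OF b, of "exp (- x)"] by (auto simp: E_def simp flip: minus_mult_left simp del: minus_diff_eq)
  have u: "u x = g (x - t) * E x" for x by (simp add: u_def E_def)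
  have L: "L \<ge> 0" using bd[of 0] by simp
  show "\<bar>u x\<bar> \<le> L"
    using mult_mono[OF bd[of "x - t"] E(2)[of x]] E[of x] L by (simp add: u abs_mult)
  have "u x - u y = (g (x - t) - g (y - t)) * E x + g (y - t) * (E x - E y)"
    by (simp add: u algebra_simps)
  also have "\<bar>\<dots>\<bar> \<le> \<bar>g (x - t) - g (y - t)\<bar> * E x + \<bar>g (y - t)\<bar> * \<bar>E x - E y\<bar>"
    using E[of x] abs_triangle_ineq[of "(g (x - t) - g (y - t)) * E x" "g (y - t) * (E x - E y)"]
    by (simp add: abs_mult)
  also have "\<dots> \<le> (K * \<bar>x - y\<bar>) * 1 + L * \<bar>x - y\<bar>"
  proof (intro add_mono mult_mono)
    show "\<bar>g (x - t) - g (y - t)\<bar> \<le> K * \<bar>x - y\<bar>"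
      using lipschitz_onD[OF lip, of "x - t" "y - t"] by (simp add: dist_real_def)
    show "\<bar>E x - E y\<bar> \<le> \<bar>x - y\<bar>" unfolding E_def by (rule double_exp_lipschitz[OF b])
  qed (use E bd L lipschitz_on_nonneg[OF lip] in auto)
  finally show "\<bar>u x - u y\<bar> \<le> (K + L) * \<bar>x - y\<bar>" by (simp add: algebra_simps)
qed

section \<open>Exponential tails\<close>

lemma space_expo1 [simp]: "space expo1 = UNIV" and sets_expo1 [simp, measurable_cong]: "sets expo1 = sets borel"
  by (simp_all add: expo1_def)

interpretation expo1: prob_space expo1
  unfolding expo1_def by (rule prob_space_exponential_density) simp

text \<open>The substitution \<open>s = x + y\<close> turns this into the integral of
  \<open>u s * exp (- s)\<close> over \<open>s \<ge> x\<close>; the form with \<open>expo1\<close>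
  matches the second term of \<open>L0\<close>.\<close>

definition exp_tail :: "(real \<Rightarrow> real) \<Rightarrow> real \<Rightarrow> real" where
  "exp_tail u x = exp (- x) * (\<integral>y. u (x + y) \<partial>expo1)"

lemma abs_exp_tail_le:
  assumes "u \<in> borel_measurable borel" and bd: "\<And>x. \<bar>u x\<bar> \<le> M"
  shows "\<bar>exp_tail u x\<bar> \<le> M * exp (- x)"
proof -
  have [measurable]: "u \<in> borel_measurable borel" by fact
  have "integrable expo1 (\<lambda>y. u (x + y))"
    using bd by (intro expo1.integrable_const_bound[where B = M]) auto
  then have "norm (\<integral>y. u (x + y) \<partial>expo1) \<le> (\<integral>y. M \<partial>expo1)"
    using bd by (intro Bochner_Integration.integral_norm_bound_integral) auto
  also have "\<dots> = M" using expo1.prob_space by simp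
  finally show ?thesis by (simp add: exp_tail_def abs_mult mult.commute)
qed

text \<open>The difference of two tails is an integral over the cell from \<open>x\<close> to
  \<open>x + d\<close>; replacing \<open>u\<close> by the constant \<open>c\<close> there costs at
  most \<open>B\<close> times the mass of the cell.\<close>

lemma exp_tail_cell:
  assumes "u \<in> borel_measurable borel" and bd: "\<And>x. \<bar>u x\<bar> \<le> M"
    and d: "d \<ge> 0" and close: "\<And>s. x \<le> s \<Longrightarrow> s \<le> x + d \<Longrightarrow> \<bar>u s - c\<bar> \<le> B"
  shows "\<bar>exp_tail u x - exp_tail u (x + d) - c * (exp (- x) - exp (- (x + d)))\<bar>
    \<le> B * (exp (- x) - exp (- (x + d)))"
proof -
  have [measurable]: "u \<in> borel_measurable borel" by fact
  define W where "W x s = indicator {x..} s * exp (- s)" for x s :: real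
  have [measurable]: "W x \<in> borel_measurable borel" for x unfolding W_def by measurable
  have "integrable lborel (exponential_density 1)"
  proof (rule integrableI_nonneg)
    show "(\<integral>\<^sup>+z. ennreal (exponential_density 1 z) \<partial>lborel) < \<infinity>"
      using nn_integral_erlang_ith_moment[of 1 0 0] by simp
  qed (auto simp: exponential_density_def)
  then have "integrable lborel (\<lambda>s. exp (- x) * exponential_density 1 (- x + 1 * s))" for x
    by (intro integrable_mult_right lborel_integrable_real_affine) auto
  moreover have "(\<lambda>s. exp (- x) * exponential_density 1 (- x + 1 * s)) = W x" for x
    by (auto simp: exponential_density_def W_def mult_exp_exp)
  ultimately have intW: "integrable lborel (W x)" for x by (simp only:)
  have tail: "exp_tail v x = (\<integral>s. W x s * v s \<partial>lborel)"
    if [measurable]: "v \<in> borel_measurable borel" for v x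
  proof -
    have "(\<integral>s. W x s * v s \<partial>lborel) = (\<integral>y. W x (x + 1 * y) * v (x + 1 * y) \<partial>lborel)"
      by (subst lborel_integral_real_affine[where c = 1 and t = x]) auto
    also have "\<dots> = (\<integral>y. exp (- x) * (exponential_density 1 y *\<^sub>R v (x + y)) \<partial>lborel)"
      by (intro Bochner_Integration.integral_cong) (auto simp: W_def exponential_density_def exp_add exp_diff exp_minus field_simps)
    also have "\<dots> = exp_tail v x"
      unfolding exp_tail_def expo1_def
      by (subst integral_density) (auto simp: exponential_density_nonneg)
    finally show ?thesis ..
  qed
  have const: "(\<integral>s. W x s \<partial>lborel) = exp (- x)" for x
    using tail[of "\<lambda>_. 1" x] expo1.prob_space by (simp add: exp_tail_def)
  have intWu: "integrable lborel (\<lambda>s. W x s * u s)" for x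
  proof (rule Bochner_Integration.integrable_bound)
    show "integrable lborel (\<lambda>s. M * W x s)" using intW by simp
    show "AE s in lborel. norm (W x s * u s) \<le> norm (M * W x s)"
    proof (rule AE_I2)
      fix s
      have "\<bar>u s\<bar> \<le> \<bar>M\<bar>" using bd[of s] by simp
      then show "norm (W x s * u s) \<le> norm (M * W x s)"
        by (simp add: abs_mult mult.commute mult_right_mono)
    qed
  qed simp
  \<comment> \<open>\<open>V\<close> is the nonnegative weight \<open>exp (- s)\<close> restricted
    to the cell.\<close>
  define V where "V s = W x s - W (x + d) s" for s
  have intV: "integrable lborel V" unfolding V_def using intW by simp
  have "exp_tail u x - exp_tail u (x + d) - c * (exp (- x) - exp (- (x + d)))
      = (\<integral>s. (W x s * u s - W (x + d) s * u s) - c * (W x s - W (x + d) s) \<partial>lborel)"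
    using intW intWu by (simp add: tail const)
  also have "\<dots> = (\<integral>s. V s * (u s - c) \<partial>lborel)"
    by (intro Bochner_Integration.integral_cong) (auto simp: V_def algebra_simps)
  finally have eq: "exp_tail u x - exp_tail u (x + d) - c * (exp (- x) - exp (- (x + d)))
      = (\<integral>s. V s * (u s - c) \<partial>lborel)" .
  have "integrable lborel (\<lambda>s. (W x s * u s - W (x + d) s * u s) - c * (W x s - W (x + d) s))"
    using intW intWu by simp
  then have int: "integrable lborel (\<lambda>s. V s * (u s - c))"
    by (simp add: V_def algebra_simps)
  have "norm (\<integral>s. V s * (u s - c) \<partial>lborel) \<le> (\<integral>s. B * V s \<partial>lborel)"
  proof (rule Bochner_Integration.integral_norm_bound_integral)
    show "norm (V s * (u s - c)) \<le> B * V s" for s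
      using close[of s] d by (auto simp: V_def W_def abs_mult mult.commute split: split_indicator)
  qed (use int intV in auto)
  also have "\<dots> = B * (exp (- x) - exp (- (x + d)))"
    using intW by (simp add: V_def const)
  finally show ?thesis unfolding eq by simp
qed

lemma L0_eq_exp_tail:
  assumes "\<And>x. (f has_real_derivative u x) (at x)"
  shows "L0 f x = - u x + exp_tail u x"
proof -
  have "deriv f = u" using assms DERIV_imp_deriv by blast
  then show ?thesis by (simp add: L0_def exp_tail_def)
qed

section \<open>The generator at the coupon collector\<close>

text \<open>With \<open>q = 1 - 1/n\<close>, \<open>z = exp (-1/n)\<close> and \<open>x m = m/n - ln n\<close>, the probability of \<open>T = m + 1\<close> is
  \<open>q^m\<close> times a cover probability for \<open>n - 1\<close> coupons, while summation by parts pairs the cover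
  probability \<open>F m\<close> for \<open>n\<close> coupons with the integral of \<open>u s * exp (-s)\<close> over \<open>[x m, x (m + 1)]\<close>, which is
  about \<open>z^m * u (x (m + 1))\<close>. The summands of \<open>b\<close> bound the three discrepancies.\<close>
lemma coupon_stein_bound:
  fixes u :: "real \<Rightarrow> real"
  assumes n: "n \<ge> 2" and "u \<in> borel_measurable borel"
    and bd: "\<And>x. \<bar>u x\<bar> \<le> M" and lip: "\<And>x y. \<bar>u x - u y\<bar> \<le> K * \<bar>x - y\<bar>"
  shows "\<bar>\<integral>\<omega>. - u (Zn n \<omega>) + exp_tail u (Zn n \<omega>) \<partial>coupon_space n\<bar>
    \<le> (K + M) / real n + 12 * M * ln (real n) / real n"
proof -
  have [measurable]: "u \<in> borel_measurable borel" by fact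
  have n0: "real n > 0" and n1: "n \<ge> 1" using n by auto
  have M: "M \<ge> 0" using bd[of 0] by simp
  have K: "K \<ge> 0" using lip[of 1 0] by simp
  define x where "x m = real m / real n - ln (real n)" for m
  define R where "R m = exp_tail u (x m)" for m
  define v where "v m = - u (x m) + R m" for m
  define q where "q = 1 - 1 / real n"
  define z where "z = exp (- 1 / real n)"
  define F where "F m = cover_prob n m n" for m
  define p where "p m = F (Suc m) - F m" for m
  define I where "I = (\<integral>\<omega>. - u (Zn n \<omega>) + exp_tail u (Zn n \<omega>) \<partial>coupon_space n)"
  have q: "0 < q" "q < 1" and z: "0 < z" "z < 1" using n by (auto simp: q_def z_def)
  have qz: "q \<le> z" using exp_ge_add_one_self[of "- 1 / real n"] by (simp add: q_def z_def)
  have F: "0 \<le> F m" "F m \<le> 1" for m using cover_prob_bounds[of n n m] by (auto simp: F_def)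
  have zm: "z ^ m = exp (- real m / real n)" for m
    by (simp add: z_def flip: exp_of_nat_mult)
  have expx: "exp (- x m) = real n * z ^ m" for m
  proof -
    have "exp (- x m) = exp (ln (real n)) * exp (- real m / real n)"
      unfolding x_def by (simp flip: exp_add)
    then show ?thesis using n0 by (simp add: zm)
  qed
  have xS: "x (Suc m) = x m + 1 / real n" for m
    by (simp add: x_def add_divide_distrib)
  have R_le: "\<bar>R m\<bar> \<le> M * real n * z ^ m" for m
    using abs_exp_tail_le[of u M "x m"] bd by (simp add: R_def expx)
  have p_eq: "p m = q ^ m * cover_prob (n - 1) m (n - 1)" for m
    using cover_prob_last_increment[OF n] by (simp add: p_def F_def q_def del: cover_prob.simps)
  \<comment> \<open>This inequality and \<open>q \<le> z\<close> fix the signs of two errors, so the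
    sums of their absolute values are differences of series known in closed form.\<close>
  have pF: "q ^ m * F m \<le> p m" for m
    unfolding p_eq F_def using cover_prob_fewer_coupons[OF n] q by (intro mult_left_mono) auto
  have p0: "p m \<ge> 0" for m using pF[of m] F(1)[of m] q by (meson mult_nonneg_nonneg order_trans zero_le_power less_imp_le)
  have psum: "(\<Sum>m<N. p m) \<le> 1" for N
    using F(2)[of N] F(1)[of 0] sum_lessThan_telescope[of F N] by (simp add: p_def)
  have p_summable: "summable p" using p0 psum by (rule summableI_nonneg_bounded)
  have p_le: "suminf p \<le> 1" using p_summable psum by (rule suminf_le_const)

  have "(\<lambda>m. p m * v (Suc m)) sums (\<integral>\<omega>. v (coupon_T n \<omega>) \<partial>coupon_space n)"
    unfolding p_def F_def
  proof (rule expectation_coupon_T[OF n1])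
    fix m
    have "z ^ m \<le> 1" using z by (simp add: power_le_one)
    then have "M * real n * z ^ m \<le> M * real n" using M by (simp add: mult_left_le)
    then show "\<bar>v m\<bar> \<le> M + M * real n"
      using bd[of "x m"] R_le[of m] by (simp add: v_def)
  qed
  then have I: "(\<lambda>m. p m * v (Suc m)) sums I"
    by (simp add: I_def v_def R_def x_def Zn_def)

  define c where "c m = F m * (R m - R (Suc m)) - p m * u (x (Suc m))" for m
  define b where "b m = (K + M) / real n * (z ^ m * F m) + M * (z ^ m * F m - q ^ m * F m) + M * (p m - q ^ m * F m)" for m
  have F0: "F 0 = 0" using n by (simp add: F_def)
  \<comment> \<open>Summation by parts: the boundary term at 0 vanishes with \<open>F 0\<close>, the
    one at \<open>N\<close> is removed in the limit.\<close>
  have abel: "(\<Sum>m<N. p m * v (Suc m)) = F N * R N + (\<Sum>m<N. c m)" for N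
    by (induction N) (simp_all add: F0 c_def v_def p_def algebra_simps)
  have c_le: "\<bar>c m\<bar> \<le> b m" for m
  proof -
    define w where "w = exp (- x m) - exp (- (x m + 1 / real n))"
    define y where "y = u (x (Suc m))"
    have w_eq: "w = z ^ m * (real n * (1 - z))"
      using expx[of m] expx[of "Suc m"] by (simp add: w_def xS algebra_simps)
    \<comment> \<open>The cell has mass \<open>w = z^m * n * (1 - z)\<close>, and
      \<open>n * (1 - z)\<close> lies between \<open>1 - 1/n\<close> and 1.\<close>
    have "real n * (1 - z) \<le> 1" using qz n0 by (simp add: q_def field_simps)
    then have w_le: "w \<le> z ^ m" unfolding w_eq using z by (simp add: mult_left_le)
    have "1 - real n * (1 - z) \<le> 1 / real n"
    proof -
      have "(1 + 1 / real n) * z \<le> exp (1 / real n) * z"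
        using z exp_ge_add_one_self by (intro mult_right_mono) auto
      also have "\<dots> = 1" by (simp add: z_def mult_exp_exp)
      finally have "real n * z + z \<le> real n" using n0 by (simp add: field_simps)
      then have "(1 - real n * (1 - z)) \<le> 1 - z" by (simp add: algebra_simps)
      also have "\<dots> \<le> 1 / real n" using qz by (simp add: q_def)
      finally show ?thesis .
    qed
    then have "z ^ m * (1 - real n * (1 - z)) \<le> z ^ m * (1 / real n)"
      using z by (intro mult_left_mono) auto
    then have w_ge: "z ^ m - w \<le> z ^ m / real n" by (simp add: w_eq algebra_simps)
    have qzm: "q ^ m \<le> z ^ m" using qz q by (intro power_mono) auto
    have cell: "\<bar>R m - R (Suc m) - y * w\<bar> \<le> K / real n * w"
      unfolding R_def w_def xS
    proof (rule exp_tail_cell[OF _ bd])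
      fix s assume "x m \<le> s" "s \<le> x m + 1 / real n"
      then have "\<bar>s - x (Suc m)\<bar> \<le> 1 / real n" by (simp add: xS)
      then show "\<bar>u s - y\<bar> \<le> K / real n"
        using order_trans[OF lip mult_left_mono[OF _ K], of s "x (Suc m)" "1 / real n"] by (simp add: y_def)
    qed auto
    \<comment> \<open>The three errors are the variation of \<open>u\<close> within a cell, the cell
      mass \<open>w\<close> against \<open>q^m\<close>, and \<open>F m\<close> against the cover
      probability for \<open>n - 1\<close> coupons.\<close>
    have "c m = F m * (R m - R (Suc m) - y * w) + F m * y * (w - q ^ m) - (p m - q ^ m * F m) * y"
      by (simp add: c_def y_def algebra_simps)
    also have "\<bar>\<dots>\<bar> \<le> F m * \<bar>R m - R (Suc m) - y * w\<bar> + F m * \<bar>y\<bar> * \<bar>w - q ^ m\<bar> + (p m - q ^ m * F m) * \<bar>y\<bar>"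
      using F(1)[of m] pF[of m] by (intro order_trans[OF abs_triangle_ineq4] add_mono order_trans[OF abs_triangle_ineq]) (simp_all add: abs_mult)
    also have "\<dots> \<le> F m * (K / real n * z ^ m) + F m * M * (z ^ m / real n + (z ^ m - q ^ m)) + (p m - q ^ m * F m) * M"
    proof (intro add_mono mult_mono)
      show "\<bar>R m - R (Suc m) - y * w\<bar> \<le> K / real n * z ^ m"
        using cell mult_left_mono[OF w_le, of "K / real n"] K n0 by simp
      show "\<bar>w - q ^ m\<bar> \<le> z ^ m / real n + (z ^ m - q ^ m)"
        using w_le w_ge qzm by linarith
    qed (use F pF[of m] bd M in \<open>auto simp: y_def\<close>)
    also have "\<dots> = b m" using n0 by (simp add: b_def field_simps)
    finally show ?thesis .
  qed

  define S1 where "S1 = (\<Sum>m. z ^ m * F m)"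
  define S2 where "S2 = (\<Sum>m. q ^ m * F m)"
  have sum1: "summable (\<lambda>m. z ^ m * F m)" and sum2: "summable (\<lambda>m. q ^ m * F m)"
    unfolding F_def using z q by (auto intro!: summable_cover_prob)
  have b_sums: "b sums ((K + M) / real n * S1 + M * (S1 - S2) + M * (suminf p - S2))"
    unfolding b_def S1_def S2_def using sum1 sum2 p_summable
    by (intro sums_add sums_mult sums_diff summable_sums)
  have "S1 \<le> 1" using suminf_cover_prob_exp_le[OF n1] by (simp add: S1_def z_def F_def)
  moreover have S2: "S2 \<ge> 1 - 6 * ln (real n) / real n"
    using suminf_cover_prob_ge[OF n] by (simp add: S2_def q_def F_def)
  \<comment> \<open>Both \<open>S1\<close> and \<open>suminf p\<close> are at most 1, so each
    difference with \<open>S2\<close> is at most \<open>6 * ln n / n\<close>; together they give the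
    constant 12.\<close>
  ultimately have "(K + M) / real n * S1 + M * (S1 - S2) + M * (suminf p - S2)
      \<le> (K + M) / real n * 1 + M * (6 * ln (real n) / real n) + M * (6 * ln (real n) / real n)"
    using K M n0 p_le by (intro add_mono mult_left_mono) auto
  then have b_le: "suminf b \<le> (K + M) / real n + 12 * M * ln (real n) / real n"
    using b_sums by (simp add: sums_iff)

  \<comment> \<open>The boundary term \<open>F N * R N\<close> is at most \<open>M * n * z^N\<close>
    in absolute value and tends to 0.\<close>
  have "\<bar>I\<bar> \<le> 0 + suminf b"
  proof (rule LIMSEQ_le)
    show "(\<lambda>N. \<bar>\<Sum>m<N. p m * v (Suc m)\<bar>) \<longlonglongrightarrow> \<bar>I\<bar>"
      using I unfolding sums_def by (rule tendsto_rabs)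
    have "(\<lambda>N. M * real n * z ^ N) \<longlonglongrightarrow> M * real n * 0"
      using z by (intro tendsto_mult_left LIMSEQ_power_zero) auto
    then show "(\<lambda>N. M * real n * z ^ N + suminf b) \<longlonglongrightarrow> 0 + suminf b"
      by (intro tendsto_add) auto
    have "\<bar>\<Sum>m<N. p m * v (Suc m)\<bar> \<le> M * real n * z ^ N + suminf b" for N
    proof -
      have "\<bar>F N * R N\<bar> \<le> 1 * (M * real n * z ^ N)"
        unfolding abs_mult using F[of N] R_le[of N] by (intro mult_mono) auto
      moreover have "\<bar>\<Sum>m<N. c m\<bar> \<le> (\<Sum>m<N. b m)"
        using c_le by (intro order_trans[OF sum_abs] sum_mono)
      moreover have "(\<Sum>m<N. b m) \<le> suminf b"
        using b_sums c_le by (intro sum_le_suminf) (auto simp: sums_iff intro: order_trans[OF abs_ge_zero])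
      ultimately show ?thesis unfolding abel by linarith
    qed
    then show "\<exists>N. \<forall>k\<ge>N. \<bar>\<Sum>m<k. p m * v (Suc m)\<bar> \<le> M * real n * z ^ k + suminf b" by blast
  qed
  then show ?thesis using b_le by (simp add: I_def)
qed

theorem theorem3p9:
  fixes h :: "real \<Rightarrow> real"
  assumes "Lip2 h"
  shows "\<exists>C>0. \<forall>t\<in>{0..1}. \<forall>n::nat. n \<ge> 2 \<longrightarrow>
           \<bar>\<integral>\<omega>. L0 (P0 t h) (Zn n \<omega>) \<partial>coupon_space n\<bar> \<le> C * ln (real n) / real n"
proof -
  obtain g K L where g: "\<And>x. (h has_real_derivative g x) (at x)" "K-lipschitz_on UNIV g"
    "\<And>x. \<bar>g x\<bar> \<le> L" "L-lipschitz_on UNIV h"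
    by (rule Lip2_derivative[OF assms]) (rule that, simp_all)
  have K: "K \<ge> 0" and L: "L \<ge> 0" using g(2,4) by (auto intro: lipschitz_on_nonneg)
  \<comment> \<open>The derivative of \<open>P0 t h\<close> is bounded by \<open>L\<close> and has
    Lipschitz constant \<open>K + L\<close>. The factor 2 comes from
    \<open>1 \<le> 2 * ln n\<close>, and the final 1 makes \<open>C\<close> positive.\<close>
  define C where "C = 2 * (K + L + L) + 12 * L + 1"
  have "\<bar>\<integral>\<omega>. L0 (P0 t h) (Zn n \<omega>) \<partial>coupon_space n\<bar> \<le> C * ln (real n) / real n"
    if t: "t \<in> {0..1}" and n: "n \<ge> 2" for t n
  proof -
    define u where "u x = g (x - t) * exp (- (exp t - 1) * exp (- x))" for x
    have t0: "t \<ge> 0" using t by simp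
    have "\<bar>\<integral>\<omega>. L0 (P0 t h) (Zn n \<omega>) \<partial>coupon_space n\<bar>
        = \<bar>\<integral>\<omega>. - u (Zn n \<omega>) + exp_tail u (Zn n \<omega>) \<partial>coupon_space n\<bar>"
      using L0_eq_exp_tail[of "P0 t h" u] P0_has_derivative[OF g(4,1) t0] by (simp add: u_def)
    also have "\<dots> \<le> (K + L + L) / real n + 12 * L * ln (real n) / real n"
    proof (rule coupon_stein_bound[OF n])
      have [measurable]: "g \<in> borel_measurable borel"
        using g(2) by (intro borel_measurable_continuous_onI lipschitz_on_continuous_on)
      show "u \<in> borel_measurable borel" unfolding u_def[abs_def] by measurable
    qed (use P0_derivative_bounds[OF g(2,3) t0] in \<open>simp_all add: u_def\<close>)
    also have "(K + L + L) / real n \<le> (K + L + L) * (2 * ln (real n)) / real n"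
      using one_le_two_ln[OF n] K L n by (intro divide_right_mono) (auto simp: mult_le_cancel_left1)
    also have "\<dots> + 12 * L * ln (real n) / real n \<le> C * ln (real n) / real n"
      using n by (simp add: C_def add_divide_distrib[symmetric] divide_right_mono algebra_simps)
    finally show ?thesis by simp
  qed
  moreover have "C > 0" using K L by (simp add: C_def)
  ultimately show ?thesis by blast
qed

end
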